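(* Let $r\ge 1$ be an integer and let $H$ be an $r$-uniform hypergraph with at least two edges. Then there exists a constant $C_H>0$ such that $$\mathrm{wsat}(n,H)=C_H\cdot n^{s(H)-1}(1+o(1))\qquad\text{as } n\to\infty,$$ where $\mathrm{wsat}(n,H)$ is the weak saturation number of $H$ and $s(H)$ is the sparseness of $H$.
   Context: All hypergraphs are finite. An $r$-uniform hypergraph $H$ has a vertex set $V(H)$ and an edge set $E(H)\subseteq\binom{V(H)}{r}$, i.e. a set of $r$-element subsets of $V(H)$. $K_n^r$ denotes the complete $r$-uniform hypergraph on $n$ vertices (all $r$-subsets are edges). A copy of $H$ in a hypergraph $F$ is a (not necessarily induced) subhypergraph of $F$ isomorphic to $H$. Given an $r$-uniform hypergraph $H$, an $H$-bootstrap percolation process is a sequence of $r$-uniform hypergraphs $F_0\subset F_1\subset\dots\subset F_m$ (on the same vertex set) such that, for each $i\ge 1$, $F_i$ is obtained from $F_{i-1}$ by adding one edge that creates a new copy of $H$ (that is, $F_i$ contains a copy of $H$ that uses the added edge). An $r$-uniform hypergraph $F$ on $n$ vertices is weakly $H$-saturated if there exists an $H$-bootstrap percolation process $F=F_0\subset F_1\subset\dots\subset F_m=K_n^r$ (with $m=0$ allowed). The weak saturation number $\mathrm{wsat}(n,H)$ is the minimum number of edges in a weakly $H$-saturated $r$-uniform hypergraph on $n$ vertices. For a non-empty $r$-uniform hypergraph $H$ (one having at least one edge), the sparseness $s(H)$ is the size of the smallest subset $S\subseteq V(H)$ such that there exists exactly one edge $U\in E(H)$ with $S\subseteq U$. One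 has $0\le s(H)\le r$. *)

theory Defs
  imports Complex_Main "HOL-Library.Landau_Symbols"
begin

record 'a hypergraph =
  hverts :: "'a set"
  hedges :: "'a set set"

definition uniform_hypergraph :: "nat \<Rightarrow> 'a hypergraph \<Rightarrow> bool" where
  "uniform_hypergraph r H \<longleftrightarrow>
     finite (hverts H) \<and> (\<forall>e \<in> hedges H. e \<subseteq> hverts H \<and> card e = r)"

definition complete_hypergraph :: "nat \<Rightarrow> 'a set \<Rightarrow> 'a hypergraph" where
  "complete_hypergraph r V = \<lparr>hverts = V, hedges = {e. e \<subseteq> V \<and> card e = r}\<rparr>"

definition subhypergraph :: "'a hypergraph \<Rightarrow> 'a hypergraph \<Rightarrow> bool" where
  "subhypergraph G F \<longleftrightarrow> hverts G \<subseteq> hverts F \<and> hedges G \<subseteq> hedges F"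

definition hypergraph_iso :: "'a hypergraph \<Rightarrow> 'b hypergraph \<Rightarrow> bool" where
  "hypergraph_iso H G \<longleftrightarrow>
     (\<exists>f. bij_betw f (hverts H) (hverts G) \<and> hedges G = (\<lambda>e. f ` e) ` hedges H)"

definition copy_in :: "'a hypergraph \<Rightarrow> 'b hypergraph \<Rightarrow> 'b hypergraph \<Rightarrow> bool" where
  "copy_in H G F \<longleftrightarrow> subhypergraph G F \<and> hypergraph_iso H G"

definition bootstrap_process ::
  "nat \<Rightarrow> 'a hypergraph \<Rightarrow> (nat \<Rightarrow> 'b hypergraph) \<Rightarrow> nat \<Rightarrow> bool" where
  "bootstrap_process r H F m \<longleftrightarrow>
     (\<forall>i\<le>m. uniform_hypergraph r (F i)) \<and>
     (\<forall>i<m. hverts (F (Suc i)) = hverts (F i) \<and>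
        (\<exists>e. e \<notin> hedges (F i) \<and> hedges (F (Suc i)) = insert e (hedges (F i)) \<and>
             (\<exists>G. copy_in H G (F (Suc i)) \<and> e \<in> hedges G)))"

definition weakly_saturated :: "nat \<Rightarrow> 'a hypergraph \<Rightarrow> 'b hypergraph \<Rightarrow> bool" where
  "weakly_saturated r H F0 \<longleftrightarrow>
     (\<exists>F m. bootstrap_process r H F m \<and> F 0 = F0 \<and>
            F m = complete_hypergraph r (hverts F0))"

text \<open>
  Weak saturation is invariant under isomorphism, so the \<open>n\<close>-vertex hypergraphs are taken on the
  vertex set \<open>{..<n}\<close>. The minimum exists because the complete hypergraph is weakly saturated
  (take \<open>m = 0\<close>).
\<close>

definition wsat :: "nat \<Rightarrow> nat \<Rightarrow> 'a hypergraph \<Rightarrow> nat" where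
  "wsat r n H = (LEAST k. \<exists>F :: nat hypergraph.
     uniform_hypergraph r F \<and> hverts F = {..<n} \<and> weakly_saturated r H F \<and> card (hedges F) = k)"

text \<open>
  For a non-empty uniform \<open>H\<close> the minimum exists, since an edge is contained in no edge but itself.
  If \<open>H\<close> has at least two edges, the empty set is contained in more than one edge, so the
  sparseness is at least 1.
\<close>

definition sparseness :: "'a hypergraph \<Rightarrow> nat" where
  "sparseness H = (LEAST k. \<exists>S. S \<subseteq> hverts H \<and> card S = k \<and> (\<exists>!U. U \<in> hedges H \<and> S \<subseteq> U))"

end

(* Write s for the sparseness and t = s - 1.

   Lower bound: a set of at most t vertices of an edge of H lies in a second edge of H, so an edge
   is never added unless each of its t-subsets is already covered; hence the initial edges cover
   all t-subsets of the vertex set.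

   Upper bound: fix a core A of |V(H)| vertices. Once all edges with at most t vertices outside A
   are present, everything percolates, by induction on the number of vertices outside A (embed H so
   that a minimal set contained in a single edge goes outside A). To produce these edges, arrange
   the vertices in k columns of about n/k rows, and put optimal (|A| + k)-vertex configurations on
   the union of A with the graph of each polynomial of degree below t modulo q, where q is about n/k
   and congruent to 1 modulo k!, so that interpolation at k points works. These q^t blocks contain
   each edge with at most t vertices outside A, unless two of those vertices share a column, and
   there are only O(n^t / k) such exceptions, which are added by hand. *)

theory Submission
  imports Defs "HOL-Computational_Algebra.Polynomial" "HOL-Number_Theory.Cong"
    "HOL-Library.FuncSet" "HOL-Real_Asymp.Real_Asymp"
begin

section \<open>Percolation as an order-free closure, and its agreement with processes\<close>

section \<open>Percolation closure\<close>

text \<open>Records which edges can be reached from \<open>E\<close>, without the order in which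
  they appear. The rule \<open>step\<close> also admits an image that is already present, so closure
  arguments need no freshness checks.\<close>

inductive_set percolation_closure :: "'a hypergraph \<Rightarrow> 'b set \<Rightarrow> 'b set set \<Rightarrow> 'b set set"
  for H :: "'a hypergraph" and V :: "'b set" and E :: "'b set set" where
  base: "e \<in> E \<Longrightarrow> e \<in> percolation_closure H V E"
| step: "inj_on f (hverts H) \<Longrightarrow> f ` hverts H \<subseteq> V \<Longrightarrow> U \<in> hedges H \<Longrightarrow>
    (\<And>W. W \<in> hedges H \<Longrightarrow> W \<noteq> U \<Longrightarrow> f ` W \<in> percolation_closure H V E) \<Longrightarrow>
    f ` U \<in> percolation_closure H V E"

text \<open>Composing an embedding of \<open>H\<close> with \<open>g\<close> gives an embedding into
  \<open>V\<close>, so derivations are transported. Sending \<open>D\<close> into the closure rather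
  than into \<open>E\<close> covers idempotence (\<open>g = id\<close>) as well as percolation
  inside a block.\<close>

lemma percolation_closure_map:
  assumes "e \<in> percolation_closure H W D" and "inj_on g W" and "g ` W \<subseteq> V"
    and D: "\<And>d. d \<in> D \<Longrightarrow> g ` d \<in> percolation_closure H V E"
  shows "g ` e \<in> percolation_closure H V E"
  using assms(1)
proof (induction rule: percolation_closure.induct)
  case (base e)
  then show ?case by (rule D)
next
  case (step f U)
  have "(g \<circ> f) ` U \<in> percolation_closure H V E"
  proof (rule percolation_closure.step)
    show "inj_on (g \<circ> f) (hverts H)"
      using step.hyps(1,2) assms(2) by (meson comp_inj_on inj_on_subset)
    show "(g \<circ> f) ` hverts H \<subseteq> V"
      using step.hyps(2) assms(3) by (auto simp: image_comp[symmetric])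
  qed (use step in \<open>auto simp: image_comp\<close>)
  then show ?case by (simp add: image_comp)
qed

lemma percolation_closure_mono:
  assumes "e \<in> percolation_closure H V D" and "D \<subseteq> percolation_closure H V E"
  shows "e \<in> percolation_closure H V E"
  using percolation_closure_map[OF assms(1), of id V E] assms(2) by auto

text \<open>The isomorphism onto the copy \<open>G\<close> is an embedding of \<open>H\<close>, and
  all edges of \<open>G\<close> but the added one were present one step earlier.\<close>

lemma weakly_saturated_imp_closure:
  assumes H: "uniform_hypergraph r H" and ws: "weakly_saturated r H F0"
    and e: "e \<subseteq> hverts F0" "card e = r"
  shows "e \<in> percolation_closure H (hverts F0) (hedges F0)"
proof -
  obtain F m where F: "bootstrap_process r H F m" "F 0 = F0"
    "F m = complete_hypergraph r (hverts F0)"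
    using ws by (auto simp: weakly_saturated_def)
  let ?cl = "percolation_closure H (hverts F0) (hedges F0)"
  have "i \<le> m \<Longrightarrow> hverts (F i) = hverts F0 \<and> hedges (F i) \<subseteq> ?cl" for i
  proof (induction i)
    case 0
    then show ?case using F(2) by (auto intro: percolation_closure.base)
  next
    case (Suc i)
    then have IH: "hverts (F i) = hverts F0" "hedges (F i) \<subseteq> ?cl" by auto
    from F(1) Suc.prems obtain e G where
      v: "hverts (F (Suc i)) = hverts (F i)" and
      ed: "hedges (F (Suc i)) = insert e (hedges (F i))" and
      G: "copy_in H G (F (Suc i))" "e \<in> hedges G"
      unfolding bootstrap_process_def by (metis Suc_le_eq)
    from G(1) obtain f where f: "bij_betw f (hverts H) (hverts G)"
      "hedges G = (\<lambda>e. f ` e) ` hedges H" and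
      sub: "hverts G \<subseteq> hverts (F (Suc i))" "hedges G \<subseteq> hedges (F (Suc i))"
      by (auto simp: copy_in_def subhypergraph_def hypergraph_iso_def)
    from G(2) f(2) obtain U where U: "U \<in> hedges H" "e = f ` U" by auto
    have inj: "inj_on f (hverts H)" and im: "f ` hverts H = hverts G"
      using f(1) by (auto simp: bij_betw_def)
    have "f ` U \<in> ?cl"
    proof (rule percolation_closure.step[OF inj _ U(1)])
      show "f ` hverts H \<subseteq> hverts F0" using im sub(1) v IH(1) by auto
      fix W assume W: "W \<in> hedges H" "W \<noteq> U"
      \<comment> \<open>Injectivity on vertices keeps the images of distinct edges apart, so the
        image of \<open>W\<close> is not the added edge.\<close>
      have "f ` W \<noteq> f ` U"
        using W U(1) H inj by (metis inj_on_image_eq_iff uniform_hypergraph_def)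
      moreover have "f ` W \<in> insert e (hedges (F i))"
      proof -
        have "f ` W \<in> hedges G" unfolding f(2) using W(1) by (rule imageI)
        then show ?thesis using sub(2) unfolding ed by (rule rev_subsetD)
      qed
      ultimately show "f ` W \<in> ?cl" using U(2) IH(2) by auto
    qed
    then show ?case using v ed IH U(2) by auto
  qed
  from this[of m] e F(3) show ?thesis by (auto simp: complete_hypergraph_def)
qed

lemma weakly_saturated_insert:
  assumes H: "uniform_hypergraph r H" and V: "finite V"
    and E: "E \<subseteq> {e. e \<subseteq> V \<and> card e = r}"
    and f: "inj_on f (hverts H)" "f ` hverts H \<subseteq> V" and U: "U \<in> hedges H"
    and new: "f ` U \<notin> E"
    and old: "\<And>W. W \<in> hedges H \<Longrightarrow> W \<noteq> U \<Longrightarrow> f ` W \<in> E"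
    and ws: "weakly_saturated r H \<lparr>hverts = V, hedges = insert (f ` U) E\<rparr>"
  shows "weakly_saturated r H \<lparr>hverts = V, hedges = E\<rparr>"
proof -
  obtain F m where F: "bootstrap_process r H F m"
    "F 0 = \<lparr>hverts = V, hedges = insert (f ` U) E\<rparr>"
    "F m = complete_hypergraph r V"
    using ws unfolding weakly_saturated_def hypergraph.select_convs by blast
  define F' where "F' = (\<lambda>i. case i of 0 \<Rightarrow> \<lparr>hverts = V, hedges = E\<rparr> | Suc j \<Rightarrow> F j)"
  let ?G = "\<lparr>hverts = f ` hverts H, hedges = (\<lambda>e. f ` e) ` hedges H\<rparr>"
  have F'0: "F' 0 = \<lparr>hverts = V, hedges = E\<rparr>" and F'Suc: "F' (Suc j) = F j" for j
    by (simp_all add: F'_def)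
  have "hypergraph_iso H ?G"
    unfolding hypergraph_iso_def by (intro exI[of _ f]) (simp add: f(1) inj_on_imp_bij_betw)
  moreover have "(\<lambda>e. f ` e) ` hedges H \<subseteq> insert (f ` U) E" using old by blast
  ultimately have "copy_in H ?G (F' (Suc 0))"
    using f(2) by (simp add: copy_in_def subhypergraph_def F'Suc F(2))
  moreover have "f ` U \<in> hedges ?G" using U by simp
  ultimately have c: "\<exists>G. copy_in H G (F' (Suc 0)) \<and> f ` U \<in> hedges G" by blast
  have u: "uniform_hypergraph r (F' 0)"
    using V E by (auto simp: uniform_hypergraph_def F'0)
  have "bootstrap_process r H F' (Suc m)"
    unfolding bootstrap_process_def
  proof (intro conjI allI impI)
    fix i assume "i \<le> Suc m"
    then show "uniform_hypergraph r (F' i)"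
      using u F(1) by (cases i) (simp_all add: F'Suc bootstrap_process_def)
  next
    fix i assume i: "i < Suc m"
    show "hverts (F' (Suc i)) = hverts (F' i)"
      using F(1,2) i by (cases i) (simp_all add: F'0 F'Suc bootstrap_process_def)
    show "\<exists>e. e \<notin> hedges (F' i) \<and> hedges (F' (Suc i)) = insert e (hedges (F' i)) \<and>
             (\<exists>G. copy_in H G (F' (Suc i)) \<and> e \<in> hedges G)"
    proof (cases i)
      case 0
      have "f ` U \<notin> hedges (F' 0) \<and> hedges (F' (Suc 0)) = insert (f ` U) (hedges (F' 0))"
        using new F(2) by (simp add: F'0 F'Suc)
      then show ?thesis using c unfolding 0 by blast
    next
      case (Suc j)
      then have "j < m" using i by simp
      then show ?thesis using F(1) unfolding Suc F'Suc bootstrap_process_def by blast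
    qed
  qed
  moreover have "F' (Suc m) = complete_hypergraph r V" using F(3) by (simp add: F'Suc)
  ultimately show ?thesis
    unfolding weakly_saturated_def hypergraph.select_convs using F'0 by blast
qed

lemma weakly_saturated_complete:
  assumes "finite V"
  shows "weakly_saturated r H (complete_hypergraph r V)"
proof -
  have "uniform_hypergraph r (complete_hypergraph r V)"
    using assms by (simp add: uniform_hypergraph_def complete_hypergraph_def)
  moreover have "hverts (complete_hypergraph r V) = V" by (simp add: complete_hypergraph_def)
  ultimately show ?thesis
    unfolding weakly_saturated_def bootstrap_process_def
    by (intro exI[of _ "\<lambda>_. complete_hypergraph r V"] exI[of _ 0]) simp
qed

text \<open>Induction on the number of missing edges: each round puts one step with a fresh edge in
  front of the process given by the induction hypothesis.\<close>

lemma closure_imp_weakly_saturated: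
  assumes H: "uniform_hypergraph r H" and V: "finite V"
    and "E \<subseteq> {e. e \<subseteq> V \<and> card e = r}"
    and "{e. e \<subseteq> V \<and> card e = r} \<subseteq> percolation_closure H V E"
  shows "weakly_saturated r H \<lparr>hverts = V, hedges = E\<rparr>"
  using assms(3,4)
proof (induction "card ({e. e \<subseteq> V \<and> card e = r} - E)" arbitrary: E rule: less_induct)
  case less
  let ?K = "{e. e \<subseteq> V \<and> card e = r}"
  have fin: "finite ?K" using V by simp
  show ?case
  proof (cases "E = ?K")
    case True
    then show ?thesis using weakly_saturated_complete[OF V, of r H]
      by (simp add: complete_hypergraph_def)
  next
    case False
    \<comment> \<open>Otherwise \<open>E\<close> would be closed under \<open>step\<close>, hence
      contain its closure and so all \<open>r\<close>-sets.\<close>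
    have "\<exists>f U. inj_on f (hverts H) \<and> f ` hverts H \<subseteq> V \<and> U \<in> hedges H \<and> f ` U \<notin> E \<and>
      (\<forall>W\<in>hedges H. W \<noteq> U \<longrightarrow> f ` W \<in> E)"
    proof (rule ccontr)
      assume neg: "\<not> ?thesis"
      have "e \<in> E" if "e \<in> percolation_closure H V E" for e
        using that
      proof (induction rule: percolation_closure.induct)
        case (step f U)
        show ?case
        proof (rule ccontr)
          assume "f ` U \<notin> E"
          then show False using neg step.hyps(1-3) step.IH by blast
        qed
      qed
      then have "percolation_closure H V E \<subseteq> E" by (rule subsetI)
      then show False using less.prems False by (meson order.trans subset_antisym)
    qed
    then obtain f U where f: "inj_on f (hverts H)" "f ` hverts H \<subseteq> V" "U \<in> hedges H"
      "f ` U \<notin> E" and old: "\<forall>W\<in>hedges H. W \<noteq> U \<longrightarrow> f ` W \<in> E"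
      by (elim exE conjE)
    have U: "U \<subseteq> hverts H" "card U = r" using H f(3) by (auto simp: uniform_hypergraph_def)
    have fU: "f ` U \<in> ?K"
    proof -
      have "inj_on f U" using f(1) U(1) by (rule inj_on_subset)
      then show ?thesis using U f(2) by (auto simp: card_image)
    qed
    have "weakly_saturated r H \<lparr>hverts = V, hedges = insert (f ` U) E\<rparr>"
    proof (rule less.hyps)
      show "card (?K - insert (f ` U) E) < card (?K - E)"
        using fU f(4) fin by (intro psubset_card_mono) auto
      show "insert (f ` U) E \<subseteq> ?K" using fU less.prems(1) by blast
      show "?K \<subseteq> percolation_closure H V (insert (f ` U) E)"
      proof (rule order.trans[OF less.prems(2)], rule subsetI)
        fix e assume "e \<in> percolation_closure H V E"
        then show "e \<in> percolation_closure H V (insert (f ` U) E)"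
          by (rule percolation_closure_mono) (auto intro: percolation_closure.base)
      qed
    qed
    from weakly_saturated_insert[OF H V less.prems(1) f _ this] show ?thesis
      using old by simp
  qed
qed

text \<open>Together with \<open>wsat_attained\<close>, this lets all later bounds speak of closures
  only, never of processes.\<close>

lemma wsat_le:
  assumes "uniform_hypergraph r H" and "E \<subseteq> {e. e \<subseteq> {..<n} \<and> card e = r}"
    and "{e. e \<subseteq> {..<n} \<and> card e = r} \<subseteq> percolation_closure H {..<n} E"
  shows "wsat r n H \<le> card E"
  unfolding wsat_def
proof (rule Least_le)
  show "\<exists>F :: nat hypergraph. uniform_hypergraph r F \<and> hverts F = {..<n} \<and>
    weakly_saturated r H F \<and> card (hedges F) = card E"
    using closure_imp_weakly_saturated[OF assms(1) _ assms(2,3)] assms(2)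
    by (intro exI[of _ "\<lparr>hverts = {..<n}, hedges = E\<rparr>"]) (auto simp: uniform_hypergraph_def)
qed

lemma wsat_attained:
  assumes H: "uniform_hypergraph r H"
  obtains E where "E \<subseteq> {e. e \<subseteq> {..<n} \<and> card e = r}" "card E = wsat r n H"
    "{e. e \<subseteq> {..<n} \<and> card e = r} \<subseteq> percolation_closure H {..<n} E"
proof -
  let ?P = "\<lambda>k. \<exists>F :: nat hypergraph. uniform_hypergraph r F \<and> hverts F = {..<n} \<and>
    weakly_saturated r H F \<and> card (hedges F) = k"
  have "?P (card (hedges (complete_hypergraph r {..<n})))"
    using weakly_saturated_complete[of "{..<n}" r H]
    by (intro exI[of _ "complete_hypergraph r {..<n}"])
      (auto simp: uniform_hypergraph_def complete_hypergraph_def)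
  then have "?P (wsat r n H)" unfolding wsat_def by (rule LeastI)
  then obtain F :: "nat hypergraph" where F: "uniform_hypergraph r F" "hverts F = {..<n}"
    "weakly_saturated r H F" "card (hedges F) = wsat r n H" by blast
  show ?thesis
    by (rule that[of "hedges F"])
      (use F weakly_saturated_imp_closure[OF H F(3)] in \<open>auto simp: uniform_hypergraph_def\<close>)
qed

section \<open>Sets that single out one edge\<close>

section \<open>Sparseness\<close>

lemma sparseness_attained:
  assumes H: "uniform_hypergraph r H" and "hedges H \<noteq> {}"
  obtains S U where "U \<in> hedges H" "S \<subseteq> U" "card S = sparseness H"
    "\<And>W. W \<in> hedges H \<Longrightarrow> S \<subseteq> W \<Longrightarrow> W = U"
proof -
  let ?P = "\<lambda>k. \<exists>S. S \<subseteq> hverts H \<and> card S = k \<and> (\<exists>!U. U \<in> hedges H \<and> S \<subseteq> U)"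
  obtain X where X: "X \<in> hedges H" using assms(2) by auto
  have "X = W" if "W \<in> hedges H" "X \<subseteq> W" for W
    using that X H by (metis card_subset_eq finite_subset uniform_hypergraph_def)
  then have "?P (card X)"
    using X H unfolding uniform_hypergraph_def by (intro exI[of _ X]) blast
  then have "?P (sparseness H)" unfolding sparseness_def by (rule LeastI)
  then obtain S where S: "card S = sparseness H" "\<exists>!U. U \<in> hedges H \<and> S \<subseteq> U" by blast
  then obtain U where "U \<in> hedges H" "S \<subseteq> U" by blast
  then show ?thesis using S by (intro that[of U S]) blast+
qed

text \<open>\<open>T\<close> does lie in the edge \<open>U\<close>, so by minimality only uniqueness
  can fail.\<close>

lemma below_sparseness:
  assumes H: "uniform_hypergraph r H" and U: "U \<in> hedges H" "T \<subseteq> U" and "card T < sparseness H"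
  obtains W where "W \<in> hedges H" "W \<noteq> U" "T \<subseteq> W"
proof -
  have "\<not> (\<exists>S. S \<subseteq> hverts H \<and> card S = card T \<and> (\<exists>!U. U \<in> hedges H \<and> S \<subseteq> U))"
    using assms(4) unfolding sparseness_def by (rule not_less_Least)
  moreover have "T \<subseteq> hverts H" using U H by (auto simp: uniform_hypergraph_def)
  ultimately have "\<not> (\<exists>!U. U \<in> hedges H \<and> T \<subseteq> U)" by simp
  then have "\<exists>W. W \<in> hedges H \<and> W \<noteq> U \<and> T \<subseteq> W" using U by metis
  then show ?thesis using that by (elim exE conjE)
qed

lemma sparseness_pos:
  assumes H: "uniform_hypergraph r H" and "card (hedges H) \<ge> 2"
  shows "sparseness H > 0"
proof (rule ccontr)
  assume zero: "\<not> ?thesis"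
  have "hedges H \<noteq> {}" using assms(2) by auto
  then obtain S U where S: "U \<in> hedges H" "S \<subseteq> U" "card S = sparseness H"
    "\<And>W. W \<in> hedges H \<Longrightarrow> S \<subseteq> W \<Longrightarrow> W = U" by (rule sparseness_attained[OF H]) blast
  have "finite S"
    using S(1,2) H by (meson finite_subset uniform_hypergraph_def)
  moreover have "card S = 0" using S(3) zero by simp
  ultimately have "S = {}" using card_0_eq by blast
  then have "hedges H \<subseteq> {U}" using S(4) by auto
  then have "card (hedges H) \<le> card {U}" by (intro card_mono) simp_all
  then show False using assms(2) by simp
qed

lemma sparseness_le:
  assumes H: "uniform_hypergraph r H" and "hedges H \<noteq> {}"
  shows "sparseness H \<le> r"
proof -
  obtain S U where S: "U \<in> hedges H" "S \<subseteq> U" "card S = sparseness H"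
    by (rule sparseness_attained[OF assms]) blast
  then have "card S \<le> card U" using H
    by (intro card_mono) (auto simp: uniform_hypergraph_def intro: finite_subset)
  then show ?thesis using S H by (auto simp: uniform_hypergraph_def)
qed

section \<open>Covering of small sets by the initial edges\<close>

section \<open>Lower bound\<close>

text \<open>The preimage of \<open>T\<close> in \<open>U\<close> lies in a second edge
  \<open>W\<close>, whose image contains \<open>T\<close> and was derived earlier, so
  \<open>T\<close> can be traced back to \<open>E\<close>.\<close>

lemma small_set_covered:
  assumes H: "uniform_hypergraph r H" and "e \<in> percolation_closure H V E"
    and "T \<subseteq> e" and "card T < sparseness H"
  shows "\<exists>d\<in>E. T \<subseteq> d"
  using assms(2,3)
proof (induction rule: percolation_closure.induct)
  case (base e)
  then show ?case by blast
next
  case (step f U)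
  have UH: "U \<subseteq> hverts H" using step.hyps(3) H by (auto simp: uniform_hypergraph_def)
  obtain T' where T': "T' \<subseteq> U" "T = f ` T'" using step.prems by (meson subset_imageE)
  have "card T' = card T" using T' UH step.hyps(1) by (metis card_image inj_on_subset)
  then obtain W where "W \<in> hedges H" "W \<noteq> U" "T' \<subseteq> W"
    using below_sparseness[OF H step.hyps(3) T'(1)] assms(4) by metis
  then show ?case using step.IH[of W] T'(2) by blast
qed

text \<open>As \<open>r \<le> n\<close>, every \<open>t\<close>-set extends to an
  \<open>r\<close>-set and so lies in an initial edge. All \<open>2 ^ r\<close> subsets of an edge
  are counted, since only the order of magnitude matters.\<close>

lemma wsat_lower_bound:
  assumes H: "uniform_hypergraph r H" and t: "t < sparseness H" "t \<le> r" and n: "r \<le> n"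
  shows "n choose t \<le> 2 ^ r * wsat r n H"
proof -
  obtain E where E: "E \<subseteq> {e. e \<subseteq> {..<n} \<and> card e = r}" "card E = wsat r n H"
    "{e. e \<subseteq> {..<n} \<and> card e = r} \<subseteq> percolation_closure H {..<n} E"
    by (rule wsat_attained[OF H])
  have finE: "finite E" using E(1) by (rule finite_subset) simp
  have "{T. T \<subseteq> {..<n} \<and> card T = t} \<subseteq> (\<Union>d\<in>E. Pow d)"
  proof
    fix T assume "T \<in> {T. T \<subseteq> {..<n} \<and> card T = t}"
    then have T: "T \<subseteq> {..<n}" "card T = t" by auto
    then obtain e where e: "T \<subseteq> e" "e \<subseteq> {..<n}" "card e = r"
      using exists_subset_between[of T r "{..<n}"] t n by auto
    have "e \<in> percolation_closure H {..<n} E" using e(2,3) by (intro subsetD[OF E(3)]) simp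
    then have "\<exists>d\<in>E. T \<subseteq> d" by (rule small_set_covered[OF H _ e(1)]) (simp add: T t)
    then show "T \<in> (\<Union>d\<in>E. Pow d)" by simp
  qed
  moreover have fd: "finite d" "card d = r" if "d \<in> E" for d
    using that E(1) by (auto intro: finite_subset)
  ultimately have "card {T. T \<subseteq> {..<n} \<and> card T = t} \<le> card (\<Union>d\<in>E. Pow d)"
    using finE by (intro card_mono) auto
  also have "\<dots> \<le> (\<Sum>d\<in>E. card (Pow d))" using finE by (rule card_UN_le)
  also have "\<dots> = (\<Sum>d\<in>E. 2 ^ r)" using fd by (intro sum.cong) (auto simp: card_Pow)
  finally show ?thesis using E(2) by (simp add: n_subsets mult.commute)
qed

section \<open>Percolation from a core and from blocks\<close>

section \<open>Upper bound\<close>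

text \<open>\<open>U\<close> is mapped onto \<open>e\<close> with the distinguishing set
  \<open>S\<close> going outside \<open>A\<close>. Any other edge misses a vertex of
  \<open>S\<close>, so its image has fewer vertices outside \<open>A\<close> and the induction
  hypothesis applies.\<close>

lemma core_percolates:
  assumes H: "uniform_hypergraph r H" and ne: "hedges H \<noteq> {}" and V: "finite V" and A: "A \<subseteq> V"
    and cA: "card (hverts H) \<le> card A"
    and core: "\<And>e. e \<subseteq> V \<Longrightarrow> card e = r \<Longrightarrow> card (e - A) < sparseness H \<Longrightarrow>
      e \<in> percolation_closure H V E"
    and "e \<subseteq> V" and "card e = r"
  shows "e \<in> percolation_closure H V E"
  using assms(7,8)
proof (induction "card (e - A)" arbitrary: e rule: less_induct)
  case less
  show ?case
  proof (cases "card (e - A) < sparseness H")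
    case True
    then show ?thesis by (intro core less.prems)
  next
    case False
    obtain S U where U: "U \<in> hedges H" "S \<subseteq> U" "card S = sparseness H"
      "\<And>W. W \<in> hedges H \<Longrightarrow> S \<subseteq> W \<Longrightarrow> W = U" by (rule sparseness_attained[OF H ne]) blast
    have UH: "U \<subseteq> hverts H" "card U = r" and fH: "finite (hverts H)"
      using U(1) H by (auto simp: uniform_hypergraph_def)
    have fU: "finite U" using UH(1) fH by (rule finite_subset)
    have fe: "finite e" and fA: "finite A"
      using less.prems(1) A V by (auto intro: finite_subset)
    have "card (e - A) \<le> r" using fe less.prems(2) by (metis card_mono Diff_subset)
    \<comment> \<open>\<open>S\<close> is enlarged inside \<open>U\<close> to \<open>S'\<close>,
      exactly the part of \<open>U\<close> that will land outside \<open>A\<close>.\<close>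
    then obtain S' where S': "S \<subseteq> S'" "S' \<subseteq> U" "card S' = card (e - A)"
      using exists_subset_between[of S "card (e - A)" U] U(2,3) fU UH(2) False by auto
    have fS': "finite S'" using S'(2) fU by (rule finite_subset)
    have eA: "card (e - A) + card (e \<inter> A) = r"
      using fe less.prems(2) card_Diff_subset_Int[of e A] card_mono[of e "e \<inter> A"] by auto
    have "card (U - S') = card (e \<inter> A)"
      using card_Diff_subset[OF fS' S'(2)] UH(2) S'(3) eA by simp
    then obtain g2 where g2: "bij_betw g2 (U - S') (e \<inter> A)"
      using finite_same_card_bij[of "U - S'" "e \<inter> A"] fU fe by auto
    obtain g1 where g1: "bij_betw g1 S' (e - A)"
      using finite_same_card_bij[of S' "e - A"] fS' fe S'(3) by auto
    have "card (hverts H - U) = card (hverts H) - r"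
      using card_Diff_subset[OF fU UH(1)] UH(2) by simp
    moreover have "card (A - e) = card A - card (e \<inter> A)"
      using fA by (metis card_Diff_subset_Int finite_Int inf_commute)
    \<comment> \<open>\<open>A\<close> has room for the rest of \<open>H\<close>, because at most
      \<open>r\<close> of its vertices are taken by \<open>e\<close>.\<close>
    ultimately have "card (hverts H - U) \<le> card (A - e)" using cA eA by linarith
    then obtain X where X: "X \<subseteq> A - e" "card X = card (hverts H - U)"
      by (meson obtain_subset_with_card_n)
    then obtain g3 where g3: "bij_betw g3 (hverts H - U) X"
      using finite_same_card_bij[of "hverts H - U" X] fH fA by (auto intro: finite_subset)
    define f where "f = (\<lambda>x. if x \<in> S' then g1 x else if x \<in> U then g2 x else g3 x)"
    have b1: "bij_betw f S' (e - A)" using g1 by (rule bij_betw_cong[THEN iffD1, rotated]) (simp add: f_def)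
    have b2: "bij_betw f (U - S') (e \<inter> A)" using g2 by (rule bij_betw_cong[THEN iffD1, rotated]) (simp add: f_def)
    have b3: "bij_betw f (hverts H - U) X"
      using g3 S'(2) by (elim bij_betw_cong[THEN iffD1, rotated]) (auto simp: f_def)
    have "bij_betw f (S' \<union> (U - S')) ((e - A) \<union> (e \<inter> A))"
      by (rule bij_betw_combine[OF b1 b2]) auto
    moreover have "S' \<union> (U - S') = U" "(e - A) \<union> (e \<inter> A) = e" using S'(2) by auto
    ultimately have bU: "bij_betw f U e" by simp
    have "bij_betw f (U \<union> (hverts H - U)) (e \<union> X)"
      by (rule bij_betw_combine[OF bU b3]) (use X in auto)
    moreover have "U \<union> (hverts H - U) = hverts H" using UH by auto
    ultimately have bH: "bij_betw f (hverts H) (e \<union> X)" by simp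
    have inj: "inj_on f (hverts H)" and im: "f ` hverts H \<subseteq> V"
      using bH less.prems(1) X A by (auto simp: bij_betw_def)
    have "f ` U \<in> percolation_closure H V E"
    proof (rule percolation_closure.step[OF inj im U(1)])
      fix W assume W: "W \<in> hedges H" "W \<noteq> U"
      have WH: "W \<subseteq> hverts H" "card W = r" using W H by (auto simp: uniform_hypergraph_def)
      have cW: "card (f ` W) = r" using inj WH by (metis card_image inj_on_subset)
      have "f ` W - A \<subseteq> f ` (W \<inter> S')"
      proof
        fix y assume "y \<in> f ` W - A"
        then obtain x where x: "x \<in> W" "y = f x" "f x \<notin> A" by auto
        have "x \<in> S'"
        proof (rule ccontr)
          assume "x \<notin> S'"
          then have "f x \<in> e \<inter> A \<or> f x \<in> X"
            using b2 b3 x WH by (cases "x \<in> U") (auto simp: bij_betw_def)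
          then show False using x(3) X(1) by blast
        qed
        then show "y \<in> f ` (W \<inter> S')" using x by auto
      qed
      then have "card (f ` W - A) \<le> card (f ` (W \<inter> S'))" using fS' by (intro card_mono) auto
      also have "\<dots> \<le> card (W \<inter> S')" using fS' by (intro card_image_le) auto
      also have "\<dots> < card S'"
        using fS' W U(4)[OF W(1)] S'(1) by (intro psubset_card_mono) auto
      finally have "card (f ` W - A) < card (e - A)" using S'(3) by simp
      then show "f ` W \<in> percolation_closure H V E"
        by (rule less.hyps) (use cW im WH in auto)
    qed
    then show ?thesis using bU by (simp add: bij_betw_def)
  qed
qed

text \<open>Each block gets a copy of one optimal configuration \<open>D\<close> on \<open>m\<close>
  vertices, so all its \<open>r\<close>-subsets percolate. With the extra edges \<open>R\<close>
  this supplies what \<open>core_percolates\<close> starts from.\<close>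

lemma wsat_le_blocks:
  assumes H: "uniform_hypergraph r H" and ne: "hedges H \<noteq> {}"
    and A: "A \<subseteq> {..<n}" "card (hverts H) \<le> card A"
    and B: "finite \<B>" "\<And>M. M \<in> \<B> \<Longrightarrow> M \<subseteq> {..<n} \<and> card M = m"
    and R: "R \<subseteq> {e. e \<subseteq> {..<n} \<and> card e = r}"
    and cover: "\<And>e. e \<subseteq> {..<n} \<Longrightarrow> card e = r \<Longrightarrow> card (e - A) < sparseness H \<Longrightarrow>
      e \<in> R \<or> (\<exists>M\<in>\<B>. e \<subseteq> M)"
  shows "wsat r n H \<le> card \<B> * wsat r m H + card R"
proof -
  obtain D where D: "D \<subseteq> {e. e \<subseteq> {..<m} \<and> card e = r}" "card D = wsat r m H"
    "{e. e \<subseteq> {..<m} \<and> card e = r} \<subseteq> percolation_closure H {..<m} D"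
    by (rule wsat_attained[OF H])
  have finD: "finite D" using D(1) by (rule finite_subset) simp
  have "\<exists>g. bij_betw g {..<m} M" if "M \<in> \<B>" for M
    using B(2)[OF that] finite_same_card_bij[of "{..<m}" M] by (auto intro: finite_subset)
  then obtain g where g: "\<And>M. M \<in> \<B> \<Longrightarrow> bij_betw (g M) {..<m} M" by metis
  define E where "E = (\<Union>M\<in>\<B>. (\<lambda>d. g M ` d) ` D) \<union> R"
  have finR: "finite R" using R by (rule finite_subset) simp
  have "E \<subseteq> {e. e \<subseteq> {..<n} \<and> card e = r}"
  proof -
    have "g M ` d \<subseteq> {..<n} \<and> card (g M ` d) = r" if "M \<in> \<B>" "d \<in> D" for M d
    proof -
      have d: "d \<subseteq> {..<m}" "card d = r" using that D(1) by auto
      have "inj_on (g M) d" "g M ` d \<subseteq> M"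
        using g[OF that(1)] d by (auto simp: bij_betw_def intro: inj_on_subset)
      then show ?thesis using B(2)[OF that(1)] d by (auto simp: card_image)
    qed
    then have "(\<Union>M\<in>\<B>. (\<lambda>d. g M ` d) ` D) \<subseteq> {e. e \<subseteq> {..<n} \<and> card e = r}" by blast
    then show ?thesis using R by (simp add: E_def)
  qed
  moreover have "{e. e \<subseteq> {..<n} \<and> card e = r} \<subseteq> percolation_closure H {..<n} E"
  proof
    fix e assume "e \<in> {e. e \<subseteq> {..<n} \<and> card e = r}"
    then have e: "e \<subseteq> {..<n}" "card e = r" by auto
    show "e \<in> percolation_closure H {..<n} E"
    proof (rule core_percolates[OF H ne _ A _ e])
      fix e assume e: "e \<subseteq> {..<n}" "card e = r" "card (e - A) < sparseness H"
      show "e \<in> percolation_closure H {..<n} E"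
      proof (cases "e \<in> R")
        case True
        then show ?thesis by (auto simp: E_def intro: percolation_closure.base)
      next
        case False
        then obtain M where M: "M \<in> \<B>" "e \<subseteq> M" using cover e by blast
        have inj: "inj_on (g M) {..<m}" and im: "g M ` {..<m} = M"
          using g[OF M(1)] by (auto simp: bij_betw_def)
        obtain e' where e': "e' \<subseteq> {..<m}" "e = g M ` e'"
          using M(2) im by (metis subset_imageE)
        then have "card e' = r" using inj e(2) by (metis card_image inj_on_subset)
        then have "e' \<in> percolation_closure H {..<m} D"
          using e'(1) by (intro subsetD[OF D(3)]) simp
        then have "g M ` e' \<in> percolation_closure H {..<n} E"
          by (rule percolation_closure_map[OF _ inj])
            (use M(1) B(2)[OF M(1)] im in \<open>auto simp: E_def intro: percolation_closure.base\<close>)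
        then show ?thesis using e' by simp
      qed
    qed auto
  qed
  ultimately have "wsat r n H \<le> card E" by (rule wsat_le[OF H])
  also have "\<dots> \<le> card (\<Union>M\<in>\<B>. (\<lambda>d. g M ` d) ` D) + card R"
    unfolding E_def by (rule card_Un_le)
  also have "card (\<Union>M\<in>\<B>. (\<lambda>d. g M ` d) ` D) \<le> (\<Sum>M\<in>\<B>. card ((\<lambda>d. g M ` d) ` D))"
    using B(1) by (rule card_UN_le)
  also have "\<dots> \<le> (\<Sum>M\<in>\<B>. card D)" by (intro sum_mono card_image_le finD)
  finally show ?thesis using D(2) by simp
qed

section \<open>Polynomials through given points over a possibly composite modulus\<close>

section \<open>Interpolation modulo q\<close>

text \<open>Newton's scheme: \<open>p = y i + (X - i) g\<close>, where \<open>g\<close> interpolates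
  the quotients \<open>(y j - y i) / (j - i)\<close>; division only requires the differences to be
  units mod \<open>q\<close>. Vanishing coefficients express degree below \<open>card I\<close> even
  when \<open>I\<close> is empty.\<close>

lemma interpolation_cong:
  fixes y :: "nat \<Rightarrow> int"
  assumes "finite I" and "\<And>i j. i \<in> I \<Longrightarrow> j \<in> I \<Longrightarrow> i \<noteq> j \<Longrightarrow> coprime (int i - int j) q"
  shows "\<exists>p :: int poly. (\<forall>j\<ge>card I. coeff p j = 0) \<and> (\<forall>i\<in>I. [poly p (int i) = y i] (mod q))"
  using assms
proof (induction I arbitrary: y rule: finite_induct)
  case empty
  then show ?case by (intro exI[of _ 0]) auto
next
  case (insert i I)
  have "\<exists>z. [(int j - int i) * z = 1] (mod q)" if "j \<in> I" for j
    using insert.prems[of j i] insert.hyps that by (intro cong_solve_coprime_int) auto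
  then obtain z where z: "\<And>j. j \<in> I \<Longrightarrow> [(int j - int i) * z j = 1] (mod q)" by metis
  obtain g :: "int poly" where g: "\<And>j. j \<ge> card I \<Longrightarrow> coeff g j = 0"
    "\<And>j. j \<in> I \<Longrightarrow> [poly g (int j) = z j * (y j - y i)] (mod q)"
    using insert.IH[of "\<lambda>j. z j * (y j - y i)"] insert.prems by blast
  let ?p = "[:y i:] + [:- int i, 1:] * g"
  have "coeff ?p j = 0" if "j \<ge> Suc (card I)" for j
    using that g(1)[of j] g(1)[of "j - 1"] by (cases j) auto
  moreover have "[poly ?p (int j) = y j] (mod q)" if "j \<in> insert i I" for j
  proof (cases "j = i")
    case False
    then have j: "j \<in> I" using that by simp
    have "[y i + (int j - int i) * poly g (int j) = y i + (int j - int i) * (z j * (y j - y i))] (mod q)"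
      by (intro cong_add cong_mult g(2) j cong_refl)
    also have "y i + (int j - int i) * (z j * (y j - y i)) = y i + ((int j - int i) * z j) * (y j - y i)"
      by (simp add: mult.assoc)
    also have "[\<dots> = y i + 1 * (y j - y i)] (mod q)"
      by (intro cong_add cong_mult z j cong_refl)
    finally show ?thesis by (simp add: algebra_simps)
  qed auto
  ultimately show ?case using insert.hyps by (intro exI[of _ ?p]) simp
qed

text \<open>Reducing coefficients mod \<open>q\<close> and padding with zeros puts the polynomial
  into a set of \<open>q ^ t\<close> coefficient vectors, which later bounds the number of
  blocks.\<close>

lemma interpolation_coeffs:
  fixes y :: "nat \<Rightarrow> int" and q :: int
  assumes "finite I" and "\<And>i j. i \<in> I \<Longrightarrow> j \<in> I \<Longrightarrow> i \<noteq> j \<Longrightarrow> coprime (int i - int j) q"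
    and "card I \<le> t" and "q > 0"
  shows "\<exists>c \<in> {..<t} \<rightarrow>\<^sub>E {0..<q}. \<forall>i\<in>I. [(\<Sum>j<t. c j * int i ^ j) = y i] (mod q)"
proof -
  obtain p :: "int poly" where p: "\<And>j. j \<ge> card I \<Longrightarrow> coeff p j = 0"
    "\<And>i. i \<in> I \<Longrightarrow> [poly p (int i) = y i] (mod q)"
    using interpolation_cong[OF assms(1,2)] by metis
  define c where "c = (\<lambda>j\<in>{..<t}. coeff p j mod q)"
  have "c \<in> {..<t} \<rightarrow>\<^sub>E {0..<q}" using assms(4) by (auto simp: c_def)
  moreover have "[(\<Sum>j<t. c j * int i ^ j) = y i] (mod q)" if "i \<in> I" for i
  proof -
    have "poly p x = (\<Sum>j<t. coeff p j * x ^ j)" for x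
    proof -
      have "poly p x = (\<Sum>j\<le>degree p. coeff p j * x ^ j)" by (rule poly_altdef)
      also have "\<dots> = (\<Sum>j\<in>{j. j \<le> degree p \<and> j < t}. coeff p j * x ^ j)"
        using p(1) assms(3) by (intro sum.mono_neutral_right) auto
      also have "\<dots> = (\<Sum>j<t. coeff p j * x ^ j)"
        by (intro sum.mono_neutral_left) (auto simp: coeff_eq_0)
      finally show ?thesis .
    qed
    moreover have "[(\<Sum>j<t. c j * int i ^ j) = (\<Sum>j<t. coeff p j * int i ^ j)] (mod q)"
      by (intro cong_sum cong_mult) (auto simp: c_def)
    ultimately show ?thesis using p(2)[OF that] cong_trans by metis
  qed
  ultimately show ?thesis by blast
qed

section \<open>Sets with two vertices in a column, and blocks that contain all other small
  sets\<close>

section \<open>Transversal sets and polynomial blocks\<close>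

text \<open>The size is bounded by \<open>t\<close> instead of fixed, because the part of an edge
  outside the core can be smaller.\<close>

definition nontransversal :: "nat \<Rightarrow> nat \<Rightarrow> nat \<Rightarrow> nat set set" where
  "nontransversal n k t = {T. T \<subseteq> {..<n} \<and> card T \<le> t \<and> \<not> inj_on (\<lambda>x. x mod k) T}"

lemma finite_nontransversal: "finite (nontransversal n k t)"
  by (rule finite_subset[of _ "Pow {..<n}"]) (auto simp: nontransversal_def)

text \<open>Choose \<open>x\<close> in \<open>n\<close> ways, a second vertex of its column in
  \<open>q\<close> ways by its row, and the others as a list of length \<open>t - 2\<close>. The
  factor \<open>n\<close> on the left spares a division: for \<open>q\<close> near
  \<open>n / k\<close> the bound is about \<open>n ^ t / k\<close>.\<close>

lemma card_nontransversal:
  assumes k: "k > 0" and n: "n \<le> k * q"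
  shows "n * card (nontransversal n k t) \<le> q * n ^ t"
proof (cases "nontransversal n k t = {}")
  case False
  have pair: "\<exists>x\<in>T. \<exists>y\<in>T. x \<noteq> y \<and> x mod k = y mod k \<and> finite T \<and> card T \<ge> 2"
    if "T \<in> nontransversal n k t" for T
  proof -
    from that obtain x y where xy: "x \<in> T" "y \<in> T" "x \<noteq> y" "x mod k = y mod k"
      by (auto simp: nontransversal_def inj_on_def)
    have fin: "finite T" using that by (auto simp: nontransversal_def intro: finite_subset)
    then have "card {x, y} \<le> card T" using xy by (intro card_mono) auto
    then show ?thesis using xy fin by (intro bexI[of _ x] bexI[of _ y]) auto
  qed
  from False obtain T0 where T0: "T0 \<in> nontransversal n k t" by auto
  then have "2 \<le> t" using pair[OF T0] by (auto simp: nontransversal_def)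
  then obtain u where t: "t = Suc (Suc u)" by (metis add_2_eq_Suc le_Suc_ex)
  let ?L = "{zs. set zs \<subseteq> {..<n} \<and> length zs = u}"
  let ?f = "\<lambda>(x, i, zs). insert x (insert (i * k + x mod k) (set zs))"
  have "nontransversal n k t \<subseteq> ?f ` ({..<n} \<times> {..<q} \<times> ?L)"
  proof
    fix T assume T: "T \<in> nontransversal n k t"
    then obtain x y where xy: "x \<in> T" "y \<in> T" "x \<noteq> y" "x mod k = y mod k" "finite T"
      using pair by blast
    have Tn: "T \<subseteq> {..<n}" "card T \<le> Suc (Suc u)" using T t by (auto simp: nontransversal_def)
    obtain ws where ws: "set ws = T - {x, y}" "distinct ws"
      using finite_distinct_list[of "T - {x, y}"] xy(5) by auto
    have "length ws = card (T - {x, y})" using ws distinct_card by metis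
    also have "\<dots> \<le> u" using xy Tn(2) by (simp add: card_Diff_subset)
    finally have len: "length ws \<le> u" .
    \<comment> \<open>Padding with \<open>x\<close> gives every list the length \<open>u\<close>
      without changing the resulting set.\<close>
    define zs where "zs = ws @ replicate (u - length ws) x"
    have "zs \<in> ?L" using ws len xy Tn by (auto simp: zs_def)
    moreover have "y < k * q" using Tn xy n by auto
    then have "y div k < q" using k by (simp add: less_mult_imp_div_less mult.commute)
    moreover have "T = ?f (x, y div k, zs)"
    proof -
      have "set zs \<union> {x} = T - {x, y} \<union> {x}" by (auto simp: zs_def ws(1))
      moreover have "y div k * k + x mod k = y" unfolding xy(4) by simp
      ultimately show ?thesis using xy(1,2) by auto
    qed
    moreover have "x < n" using Tn(1) xy(1) by auto
    ultimately show "T \<in> ?f ` ({..<n} \<times> {..<q} \<times> ?L)"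
      by (intro image_eqI[of T ?f "(x, y div k, zs)"]) (assumption | simp)+
  qed
  then have "card (nontransversal n k t) \<le> card ({..<n} \<times> {..<q} \<times> ?L)"
    by (rule surj_card_le[rotated]) (simp add: finite_lists_length_eq)
  also have "\<dots> = n * (q * n ^ u)"
    by (simp add: card_cartesian_product card_lists_length_eq)
  finally have "n * card (nontransversal n k t) \<le> n * (n * (q * n ^ u))" by simp
  then show ?thesis by (simp add: t mult_ac)
qed simp

text \<open>The residue mod \<open>k\<close> is the column of a vertex and its quotient is the row, so this is the
  graph of a polynomial of degree less than \<open>t\<close> over the integers mod \<open>q\<close>.\<close>

definition poly_block :: "nat \<Rightarrow> nat \<Rightarrow> nat \<Rightarrow> nat \<Rightarrow> (nat \<Rightarrow> int) \<Rightarrow> nat set" where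
  "poly_block n k q t c =
    {x. x < n \<and> [(\<Sum>j<t. c j * int (x mod k) ^ j) = int (x div k)] (mod int q)}"

text \<open>A column contains at most one vertex of the block: the rows of two such vertices are
  congruent mod \<open>q\<close>, and \<open>n \<le> k * q\<close> puts both rows below
  \<open>q\<close>.\<close>

lemma card_poly_block:
  assumes k: "k > 0" and n: "n \<le> k * q"
  shows "card (poly_block n k q t c) \<le> k"
proof -
  have "inj_on (\<lambda>x. x mod k) (poly_block n k q t c)"
  proof (rule inj_onI)
    fix x y assume x: "x \<in> poly_block n k q t c" and y: "y \<in> poly_block n k q t c"
      and eq: "x mod k = y mod k"
    have "[int (x div k) = int (y div k)] (mod int q)"
      using x y eq by (auto simp: poly_block_def intro: cong_trans cong_sym)
    moreover have "x div k < q" "y div k < q"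
      using x y n k by (auto simp: poly_block_def intro!: less_mult_imp_div_less simp: mult.commute)
    ultimately have "x div k = y div k" unfolding cong_int_iff by (rule cong_less_modulus_unique_nat)
    then show "x = y" using eq by (metis div_mult_mod_eq)
  qed
  then have "card (poly_block n k q t c) \<le> card {..<k}"
    by (rule card_inj_on_le) (use k in auto)
  then show ?thesis by simp
qed

text \<open>The difference is nonzero and smaller than \<open>k\<close> in absolute value, so it
  divides \<open>fact k\<close>; a common divisor with \<open>fact k * w + 1\<close> then divides
  1.\<close>

lemma coprime_diff_if_cong_1_fact:
  fixes i j k w :: nat
  assumes "i < k" "j < k" "i \<noteq> j"
  shows "coprime (int i - int j) (int (fact k * w + 1))"
proof -
  let ?d = "nat \<bar>int i - int j\<bar>"
  have "?d dvd fact k" using assms by (intro dvd_fact) auto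
  then have "int ?d dvd int (fact k)" by (rule of_nat_dvd_iff[THEN iffD2])
  then have "int i - int j dvd int (fact k)" by simp
  then obtain m where m: "int (fact k) = (int i - int j) * m" by (elim dvdE)
  have "int (fact k * w + 1) = (int i - int j) * (m * int w) + 1"
    by (simp only: of_nat_add of_nat_mult m of_nat_1 mult.assoc)
  then show ?thesis
    by (metis coprimeI dvd_add_right_iff dvd_mult2)
qed

text \<open>Since no column repeats, the row is a function of the column on \<open>T\<close>, given
  by \<open>the_inv_into\<close>, and can be interpolated through at most \<open>t\<close>
  points.\<close>

lemma transversal_in_poly_block:
  assumes k: "k > 0" and q: "q = fact k * w + 1"
    and T: "T \<subseteq> {..<n}" "card T \<le> t" "inj_on (\<lambda>x. x mod k) T"
  shows "\<exists>c \<in> {..<t} \<rightarrow>\<^sub>E {0..<int q}. T \<subseteq> poly_block n k q t c"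
proof -
  let ?m = "\<lambda>x. x mod k"
  have fin: "finite T" using T(1) by (rule finite_subset) simp
  have "\<exists>c \<in> {..<t} \<rightarrow>\<^sub>E {0..<int q}. \<forall>i\<in>?m ` T.
    [(\<Sum>j<t. c j * int i ^ j) = int (the_inv_into T ?m i div k)] (mod int q)"
  proof (rule interpolation_coeffs)
    show "coprime (int i - int j) (int q)" if "i \<in> ?m ` T" "j \<in> ?m ` T" "i \<noteq> j" for i j
      unfolding q by (rule coprime_diff_if_cong_1_fact) (use that k in auto)
    show "card (?m ` T) \<le> t" using T(2,3) by (simp add: card_image)
    have "q > 0" by (simp add: q)
    then show "int q > 0" by simp
  qed (use fin in simp)
  then obtain c where c: "c \<in> {..<t} \<rightarrow>\<^sub>E {0..<int q}"
    "\<And>i. i \<in> ?m ` T \<Longrightarrow> [(\<Sum>j<t. c j * int i ^ j) = int (the_inv_into T ?m i div k)] (mod int q)"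
    by blast
  have "x \<in> poly_block n k q t c" if "x \<in> T" for x
    using c(2)[OF imageI[OF that]] that T(1) the_inv_into_f_f[OF T(3) that]
    by (auto simp: poly_block_def)
  then show ?thesis using c(1) by blast
qed

lemma wsat_upper_bound:
  assumes H: "uniform_hypergraph r H" and ne: "hedges H \<noteq> {}"
    and t: "sparseness H = Suc t" and a: "a = card (hverts H)"
    and k: "k > 0" and ak: "a + k \<le> n" and q: "q = fact k * w + 1" and n: "n \<le> k * q"
  shows "wsat r n H \<le> q ^ t * wsat r (a + k) H + 2 ^ a * card (nontransversal n k t)"
proof -
  let ?A = "{..<a}"
  let ?C = "{..<t} \<rightarrow>\<^sub>E {0..<int q}"
  have finC: "finite ?C" by (intro finite_PiE) auto
  \<comment> \<open>Padded to exactly \<open>a + k\<close> vertices, since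
    \<open>wsat_le_blocks\<close> asks for blocks of one common size.\<close>
  have "\<exists>M. ?A \<union> poly_block n k q t c \<subseteq> M \<and> M \<subseteq> {..<n} \<and> card M = a + k" for c
  proof -
    have "card (?A \<union> poly_block n k q t c) \<le> a + k"
      using card_Un_le[of ?A "poly_block n k q t c"] card_poly_block[OF k n, of t c] by simp
    moreover have "?A \<union> poly_block n k q t c \<subseteq> {..<n}" using ak by (auto simp: poly_block_def)
    ultimately show ?thesis
      using exists_subset_between[of "?A \<union> poly_block n k q t c" "a + k" "{..<n}"] ak by simp
  qed
  then obtain M where M: "\<And>c. ?A \<union> poly_block n k q t c \<subseteq> M c"
    "\<And>c. M c \<subseteq> {..<n}" "\<And>c. card (M c) = a + k" by metis
  define R where "R = {e. e \<subseteq> {..<n} \<and> card e = r \<and> e - ?A \<in> nontransversal n k t}"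
  have "wsat r n H \<le> card (M ` ?C) * wsat r (a + k) H + card R"
  proof (rule wsat_le_blocks[OF H ne, of ?A])
    fix e assume e: "e \<subseteq> {..<n}" "card e = r" "card (e - ?A) < sparseness H"
    show "e \<in> R \<or> (\<exists>N\<in>M ` ?C. e \<subseteq> N)"
    proof (cases "inj_on (\<lambda>x. x mod k) (e - ?A)")
      case True
      have "e - ?A \<subseteq> {..<n}" "card (e - ?A) \<le> t" using e t by auto
      then obtain c where "c \<in> ?C" "e - ?A \<subseteq> poly_block n k q t c"
        using transversal_in_poly_block[OF k q _ _ True] by blast
      then show ?thesis using M(1)[of c] by blast
    next
      case False
      then show ?thesis using e t by (auto simp: R_def nontransversal_def)
    qed
  next
    fix N assume "N \<in> M ` ?C"
    then show "N \<subseteq> {..<n} \<and> card N = a + k" using M(2,3) by (elim imageE) simp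
  qed (use finC a ak in \<open>auto simp: R_def\<close>)
  also have "card (M ` ?C) \<le> q ^ t"
    using card_image_le[OF finC, of M] by (simp add: card_PiE)
  \<comment> \<open>An edge is determined by its traces inside and outside the core; there are
    \<open>2 ^ a\<close> possible inner traces.\<close>
  also have "card R \<le> card (Pow ?A \<times> nontransversal n k t)"
  proof (rule card_inj_on_le)
    show "inj_on (\<lambda>e. (e \<inter> ?A, e - ?A)) R" by (rule inj_onI) blast
  qed (auto simp: R_def finite_nontransversal)
  also have "\<dots> = 2 ^ a * card (nontransversal n k t)"
    by (simp add: card_cartesian_product card_Pow)
  finally show ?thesis by simp
qed

section \<open>Convergence of the ratio of \<open>wsat r n H\<close> to \<open>n ^ t\<close>\<close>

section \<open>The limit\<close>

lemma wsat_ratio_eventually_le: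
  assumes H: "uniform_hypergraph r H" and ne: "hedges H \<noteq> {}"
    and t: "sparseness H = Suc t" and a: "a = card (hverts H)"
    and k: "k > 0" and \<epsilon>: "\<epsilon> > 0"
  shows "\<forall>\<^sub>F n in at_top. real (wsat r n H) / real n ^ t
    < real (wsat r (a + k) H) / real k ^ t + 2 ^ a / real k + \<epsilon>"
proof -
  \<comment> \<open>\<open>b n\<close> bounds \<open>q / n\<close> for the modulus \<open>q\<close>
    chosen below, and it tends to \<open>1 / k\<close>.\<close>
  define b where "b = (\<lambda>n. 1 / real k + (fact k + 1) / real n)"
  let ?W = "real (wsat r (a + k) H)"
  have "(\<lambda>n. b n ^ t * ?W + 2 ^ a * b n) \<longlonglongrightarrow> (1 / real k + 0) ^ t * ?W + 2 ^ a * (1 / real k + 0)"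
    unfolding b_def by (intro tendsto_intros lim_const_over_n)
  then have "\<forall>\<^sub>F n in at_top. b n ^ t * ?W + 2 ^ a * b n < ?W / real k ^ t + 2 ^ a / real k + \<epsilon>"
    by (rule order_tendstoD) (use \<epsilon> in \<open>simp add: power_one_over field_simps\<close>)
  moreover have "\<forall>\<^sub>F n in at_top. a + k \<le> n" by (rule eventually_ge_at_top)
  ultimately show ?thesis
  proof eventually_elim
    case (elim n)
    have n0: "real n > 0" using elim k by simp
    \<comment> \<open>Going one past the quotient ensures \<open>n \<le> k * q\<close>, while
      \<open>k * q\<close> exceeds \<open>n\<close> by at most \<open>k * (fact k + 1)\<close>, a
      constant for fixed \<open>k\<close>.\<close>
    define w where "w = n div (k * fact k) + 1"
    define q where "q = fact k * w + 1"
    have pos: "k * fact k > 0" using k by simp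
    have "n \<le> (k * fact k) * w"
      unfolding w_def using dividend_less_times_div[OF pos, of n] by simp
    also have "\<dots> \<le> k * q" by (simp add: q_def)
    finally have nq: "n \<le> k * q" .
    have "(k * fact k) * (n div (k * fact k)) \<le> n" by (rule times_div_less_eq_dividend)
    then have "k * q \<le> n + k * (fact k + 1)" by (simp add: q_def w_def algebra_simps)
    then have "real (k * q) \<le> real (n + k * (fact k + 1))" by (rule of_nat_mono)
    then have qb: "real q / real n \<le> b n"
      using n0 k by (simp add: b_def field_simps)
    have "real (n * card (nontransversal n k t)) \<le> real (q * n ^ t)"
      using card_nontransversal[OF k nq, of t] by (rule of_nat_mono)
    then have nt: "real (card (nontransversal n k t)) / real n ^ t \<le> real q / real n"
      using n0 by (simp add: field_simps)
    have "real (wsat r n H) \<le> real (q ^ t * wsat r (a + k) H + 2 ^ a * card (nontransversal n k t))"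
      using wsat_upper_bound[OF H ne t a k elim(2) q_def nq] by (rule of_nat_mono)
    then have "real (wsat r n H) / real n ^ t
      \<le> real (q ^ t * wsat r (a + k) H + 2 ^ a * card (nontransversal n k t)) / real n ^ t"
      by (rule divide_right_mono) simp
    also have "\<dots> = (real q / real n) ^ t * ?W
      + 2 ^ a * (real (card (nontransversal n k t)) / real n ^ t)"
      by (simp add: add_divide_distrib power_divide)
    also have "\<dots> \<le> b n ^ t * ?W + 2 ^ a * b n"
      using qb nt by (intro add_mono mult_mono power_mono) (auto simp: b_def)
    finally show ?case using elim(1) by linarith
  qed
qed

lemma wsat_ratio_eventually_ge:
  assumes H: "uniform_hypergraph r H" and ne: "hedges H \<noteq> {}" and t: "sparseness H = Suc t"
  shows "\<exists>\<delta>>0. \<forall>\<^sub>F n in at_top. \<delta> \<le> real (wsat r n H) / real n ^ t"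
proof (intro exI conjI)
  have tr: "t \<le> r" using sparseness_le[OF H ne] t by simp
  \<comment> \<open>For \<open>t = 0\<close> the factor \<open>real t ^ t\<close> is
    \<open>0 ^ 0 = 1\<close>.\<close>
  show "1 / (real t ^ t * 2 ^ r) > 0" by (cases t) auto
  show "\<forall>\<^sub>F n in at_top. 1 / (real t ^ t * 2 ^ r) \<le> real (wsat r n H) / real n ^ t"
    using eventually_ge_at_top[of "max 1 r"]
  proof eventually_elim
    case (elim n)
    have "(real n / real t) ^ t \<le> real (n choose t)"
      using elim tr by (intro binomial_ge_n_over_k_pow_k) auto
    also have "\<dots> \<le> real (2 ^ r * wsat r n H)"
      using wsat_lower_bound[OF H _ tr, of n] t elim by (intro of_nat_mono) auto
    finally have "real n ^ t / real t ^ t \<le> 2 ^ r * real (wsat r n H)"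
      by (simp add: power_divide)
    then show ?case using elim by (cases "t = 0") (auto simp: field_simps)
  qed
qed

text \<open>A variant of Fekete's lemma: \<open>C\<close> is the infimum of the upper bounds, and taking \<open>k = n - a\<close>
  in the definition of the infimum bounds the ratio at \<open>n\<close> from below by \<open>C - o(1)\<close>.\<close>

lemma ratio_converges:
  fixes W :: "nat \<Rightarrow> real"
  assumes nonneg: "\<And>n. W n \<ge> 0" "D \<ge> 0"
    and upper: "\<And>k \<epsilon>. k > 0 \<Longrightarrow> \<epsilon> > 0 \<Longrightarrow>
      \<forall>\<^sub>F n in at_top. W n / real n ^ t < W (a + k) / real k ^ t + D / real k + \<epsilon>"
  shows "\<exists>C. (\<lambda>n. W n / real n ^ t) \<longlonglongrightarrow> C"
proof -
  define u where "u = (\<lambda>k. W (a + k) / real k ^ t + D / real k)"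
  define C where "C = Inf (u ` {0<..})"
  have bdd: "bdd_below (u ` {0<..})"
    using nonneg by (intro bdd_belowI[of _ 0]) (auto simp: u_def)
  have C_le: "C \<le> u k" if "k > 0" for k
    unfolding C_def using bdd that by (intro cInf_lower) auto
  have "(\<lambda>n. W n / real n ^ t) \<longlonglongrightarrow> C"
  proof (rule order_tendstoI)
    fix y assume "C < y"
    then obtain k where k: "k > 0" "u k < y"
      using cInf_lessD[of "u ` {0<..}" y] by (auto simp: C_def)
    \<comment> \<open>The slack \<open>y - u k\<close> makes the bound end exactly at
      \<open>y\<close>.\<close>
    have "\<forall>\<^sub>F n in at_top. W n / real n ^ t < u k + (y - u k)"
      unfolding u_def by (rule upper) (use k in \<open>auto simp: u_def\<close>)
    then show "\<forall>\<^sub>F n in at_top. W n / real n ^ t < y" by simp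
  next
    fix y assume y: "y < C"
    \<comment> \<open>This is the lower bound that \<open>C \<le> u (n - a)\<close> gives for the
      ratio at \<open>n\<close>, once the denominator \<open>(n - a) ^ t\<close> is replaced by
      \<open>n ^ t\<close>.\<close>
    have "(\<lambda>n. (C - D / (real n - real a)) * ((real n - real a) / real n) ^ t) \<longlonglongrightarrow> (C - 0) * 1 ^ t"
    proof (intro tendsto_intros)
      show "(\<lambda>n. D / (real n - real a)) \<longlonglongrightarrow> 0" by real_asymp
      show "(\<lambda>n. (real n - real a) / real n) \<longlonglongrightarrow> 1" by real_asymp
    qed
    then have "\<forall>\<^sub>F n in at_top. y < (C - D / (real n - real a)) * ((real n - real a) / real n) ^ t"
      by (rule order_tendstoD) (use y in simp)
    then show "\<forall>\<^sub>F n in at_top. y < W n / real n ^ t"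
      using eventually_gt_at_top[of a]
    proof eventually_elim
      case (elim n)
      define k where "k = n - a"
      have k: "k > 0" "n = a + k" "real n - real a = real k" using elim(2) by (auto simp: k_def)
      have "(C - D / real k) * (real k / real n) ^ t
        \<le> (W n / real k ^ t) * (real k / real n) ^ t"
        using C_le[OF k(1)] k(2) by (intro mult_right_mono) (auto simp: u_def)
      also have "\<dots> = W n / real n ^ t"
        using k by (simp add: power_divide)
      finally show ?case using elim(1) k(3) by simp
    qed
  qed
  then show ?thesis by blast
qed

theorem mainTheorem1:
  fixes r :: nat and H :: "'a hypergraph"
  assumes "r \<ge> 1"
    and "uniform_hypergraph r H"
    and "card (hedges H) \<ge> 2"
  shows "\<exists>C::real. C > 0 \<and>
           (\<lambda>n::nat. real (wsat r n H)) \<sim>[at_top] (\<lambda>n. C * real n ^ (sparseness H - 1))"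
proof -
  note H = assms(2)
  have ne: "hedges H \<noteq> {}" using assms(3) by auto
  obtain t where t: "sparseness H = Suc t"
    using sparseness_pos[OF H assms(3)] gr0_implies_Suc by blast
  let ?x = "\<lambda>n. real (wsat r n H) / real n ^ t"
  obtain C where C: "?x \<longlonglongrightarrow> C"
    using ratio_converges[of "\<lambda>n. real (wsat r n H)" "2 ^ card (hverts H)" t "card (hverts H)"]
      wsat_ratio_eventually_le[OF H ne t refl] by auto
  obtain \<delta> where "\<delta> > 0" "\<forall>\<^sub>F n in at_top. \<delta> \<le> ?x n"
    using wsat_ratio_eventually_ge[OF H ne t] by blast
  \<comment> \<open>Convergence alone would allow the limit 0; the eventual bound \<delta> excludes
    it and makes the division by \<open>C\<close> below legitimate.\<close>
  then have "C > 0" using tendsto_lowerbound[OF C] by (meson less_le_trans trivial_limit_sequentially)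
  moreover have "(\<lambda>n. real (wsat r n H)) \<sim>[at_top] (\<lambda>n. C * real n ^ t)"
  proof (rule asymp_equivI')
    have "(\<lambda>n. ?x n / C) \<longlonglongrightarrow> C / C" by (intro tendsto_divide C tendsto_const) (use \<open>C > 0\<close> in simp)
    then show "(\<lambda>n. real (wsat r n H) / (C * real n ^ t)) \<longlonglongrightarrow> 1"
      using \<open>C > 0\<close> by (simp add: mult.commute)
  qed
  ultimately show ?thesis using t by auto
qed

end
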